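(* Let $(X_i)_{i\ge 1}$ be independent (not necessarily identically distributed) nonnegative absolutely continuous random variables, where $X_i$ has a probability density function $f_i$ that is continuous on $\mathbb{R}_+=[0,\infty)$ (and $f_i=0$ on $(-\infty,0)$). For $n\ge 1$ let $Y_n=\sum_{i=1}^n X_i$, $Z_n=\max_{1\le i\le n}X_i$, and $\mathcal{D}_n=\{(y,z)\in\mathbb{R}_+^2: z\le y\le nz\}$. Then the joint PDF $g_n$ of $(Y_n,Z_n)$, which vanishes outside $\mathcal{D}_n$, is given on $\mathcal D_n$ by the recurrence relation $$\begin{aligned} g_n(y,z)&=f_n(z)\int_0^z g_{n-1}(y-z,x)\,dx+\int_0^z f_n(x)\,g_{n-1}(y-x,z)\,dx\\ &=f_n(z)\int_{\frac{y-z}{n-1}}^{\min(y-z,z)}g_{n-1}(y-z,x)\,dx+\int_{\max(y-(n-1)z,0)}^{\min(y-z,z)}f_n(x)\,g_{n-1}(y-x,z)\,dx,\end{aligned}$$ for all integers $n\ge 2$ and all $(y,z)\in\mathcal{D}_n$, with initial condition $$g_1(y,z)=f_1(y)\,\delta(y-z)=f_1(z)\,\delta(y-z),\qquad \forall (y,z)\in\mathcal{D}_1,$$ where $\delta$ is the Dirac delta. Furthermore, $g_n$ is continuous on its domain $\mathcal{D}_n$ for all integers $n\ge 2$.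
   Context: The joint PDF $g_n$ of $(Y_n,Z_n)$ is the function (a generalized function if $n=1$), extended by $0$ outside $\mathcal D_n$, with $G_n(y,z):=P(Y_n\le y,Z_n\le z)=\int_0^z\int_0^y g_n(y',z')\,dy'\,dz'$ for all $(y,z)\in\mathbb{R}_+^2$, so that $g_n=\frac{\partial^2}{\partial y\,\partial z}G_n$. A PDF is unique up to equality almost everywhere; the claim is that the functions produced by the recurrence (extended by zero) are versions of the joint PDFs. Dirac delta convention: $\delta(x)\ge 0$, $\delta(-x)=\delta(x)$, and for $a\le b$, $\int_a^b f(t)\,\delta(t-s)\,dt=f(s)$ if $a\le s\le b$ and $0$ otherwise. Endpoints count with full mass, including the case $a=b=s$. Thus, concretely, $\int_0^z g_1(u,x)\,dx=f_1(u)$ if $0\le u\le z$ and $0$ otherwise, and $\int_0^z f_2(x)\,g_1(y-x,z)\,dx=f_2(y-z)f_1(z)$ if $0\le y-z\le z$ and $0$ otherwise. For $n=1$ the claim about $g_1$ means $\int_0^z\int_0^y g_1(y',z')\,dy'\,dz'=P(X_1\le\min(y,z))$ for all $(y,z)\in\mathbb{R}_+^2$. *)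

theory Defs
  imports "HOL-Probability.Probability"
begin

text \<open>
  The joint density of the sum and the maximum is an ordinary function for two or more summands,
  but for a single summand it is a line distribution on the diagonal.  A value of type
  \<open>gfun\<close> is either an ordinary function \<open>r(y,z)\<close> or the generalized function
  \<open>\<phi>(y,z) \<delta>(y - z)\<close>, written \<open>DiagDelta \<phi>\<close>.
\<close>

datatype gfun =
    Ordinary "real \<Rightarrow> real \<Rightarrow> real"
  | DiagDelta "real \<Rightarrow> real \<Rightarrow> real"

text \<open>
  \<open>dirac_integral a b s f\<close> is \<open>\<integral>\<^sub>a\<^sup>b f(t) \<delta>(t - s) dt\<close>, the integral over
  the closed interval against the unit mass at \<open>s\<close>, so that endpoints count with full mass.
\<close>

definition dirac_integral :: "real \<Rightarrow> real \<Rightarrow> real \<Rightarrow> (real \<Rightarrow> real) \<Rightarrow> real" where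
  "dirac_integral a b s f = (LINT t:{a..b}|return borel s. f t)"

lemma dirac_integral_eq:
  assumes "f \<in> borel_measurable borel"
  shows "dirac_integral a b s f = (if a \<le> s \<and> s \<le> b then f s else 0)"
proof -
  have "(\<lambda>t. indicator {a..b} t *\<^sub>R f t) \<in> borel_measurable borel"
    using assms by measurable
  then show ?thesis
    unfolding dirac_integral_def set_lebesgue_integral_def
    by (subst integral_return) (auto simp: indicator_def)
qed

text \<open>\<open>int_fst w g z a b\<close> is \<open>\<integral>\<^sub>a\<^sup>b w(t) g(t,z) dt\<close>.\<close>

fun int_fst :: "(real \<Rightarrow> real) \<Rightarrow> gfun \<Rightarrow> real \<Rightarrow> real \<Rightarrow> real \<Rightarrow> real" where
  "int_fst w (Ordinary r) z a b = (LINT t:{a..b}|lborel. w t * r t z)"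
| "int_fst w (DiagDelta \<phi>) z a b = dirac_integral a b z (\<lambda>t. w t * \<phi> t z)"

text \<open>
  \<open>int_snd w g y a b\<close> is \<open>\<integral>\<^sub>a\<^sup>b w(x) g(y,x) dx\<close>;
  here \<open>\<delta>(y - x) = \<delta>(x - y)\<close> since \<open>\<delta>\<close> is even.
\<close>

fun int_snd :: "(real \<Rightarrow> real) \<Rightarrow> gfun \<Rightarrow> real \<Rightarrow> real \<Rightarrow> real \<Rightarrow> real" where
  "int_snd w (Ordinary r) y a b = (LINT x:{a..b}|lborel. w x * r y x)"
| "int_snd w (DiagDelta \<phi>) y a b = dirac_integral a b y (\<lambda>x. w x * \<phi> y x)"

text \<open>
  \<open>int_conv w g y z a b\<close> is \<open>\<integral>\<^sub>a\<^sup>b w(x) g(y - x,z) dx\<close>;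
  here \<open>\<delta>((y - x) - z) = \<delta>(x - (y - z))\<close>.
\<close>

fun int_conv :: "(real \<Rightarrow> real) \<Rightarrow> gfun \<Rightarrow> real \<Rightarrow> real \<Rightarrow> real \<Rightarrow> real \<Rightarrow> real" where
  "int_conv w (Ordinary r) y z a b = (LINT x:{a..b}|lborel. w x * r (y - x) z)"
| "int_conv w (DiagDelta \<phi>) y z a b = dirac_integral a b (y - z) (\<lambda>x. w x * \<phi> (y - x) z)"

text \<open>Equality of generalized functions: all integrals against continuous test functions agree.\<close>

definition gfun_eq :: "gfun \<Rightarrow> gfun \<Rightarrow> bool" where
  "gfun_eq g h \<longleftrightarrow> (\<forall>w. continuous_on UNIV w \<longrightarrow>
     (\<forall>z a b. int_fst w g z a b = int_fst w h z a b) \<and>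
     (\<forall>y a b. int_snd w g y a b = int_snd w h y a b) \<and>
     (\<forall>y z a b. int_conv w g y z a b = int_conv w h y z a b))"

text \<open>For \<open>\<phi>(y,z) \<delta>(y - z)\<close> only the values of \<open>\<phi>\<close> on the diagonal matter.\<close>

fun gfun_nonneg :: "gfun \<Rightarrow> bool" where
  "gfun_nonneg (Ordinary r) \<longleftrightarrow> (\<forall>y z. 0 \<le> r y z)"
| "gfun_nonneg (DiagDelta \<phi>) \<longleftrightarrow> (\<forall>y. 0 \<le> \<phi> y y)"

fun gfun_vanishes_outside :: "(real \<times> real) set \<Rightarrow> gfun \<Rightarrow> bool" where
  "gfun_vanishes_outside S (Ordinary r) \<longleftrightarrow> (\<forall>y z. (y, z) \<notin> S \<longrightarrow> r y z = 0)"
| "gfun_vanishes_outside S (DiagDelta \<phi>) \<longleftrightarrow> (\<forall>y. (y, y) \<notin> S \<longrightarrow> \<phi> y y = 0)"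

definition Dom :: "nat \<Rightarrow> (real \<times> real) set" where
  "Dom n = {(y, z). 0 \<le> y \<and> 0 \<le> z \<and> z \<le> y \<and> y \<le> real n * z}"

definition partial_sum :: "(nat \<Rightarrow> 'a \<Rightarrow> real) \<Rightarrow> nat \<Rightarrow> 'a \<Rightarrow> real" where
  "partial_sum X n \<omega> = (\<Sum>i=1..n. X i \<omega>)"

definition partial_max :: "(nat \<Rightarrow> 'a \<Rightarrow> real) \<Rightarrow> nat \<Rightarrow> 'a \<Rightarrow> real" where
  "partial_max X n \<omega> = Max ((\<lambda>i. X i \<omega>) ` {1..n})"

text \<open>
  The generalized function \<open>g\<close> is a joint density, supported in \<open>S\<close>, of a pair of
  nonnegative random variables \<open>(Y,Z)\<close>:
  \<open>P(Y \<le> y, Z \<le> z) = \<integral>\<^sub>0\<^sup>z \<integral>\<^sub>0\<^sup>y g(y',z') dy' dz'\<close> for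
  \<open>y, z \<ge> 0\<close>.
\<close>

definition joint_pdf ::
  "'a measure \<Rightarrow> ('a \<Rightarrow> real) \<Rightarrow> ('a \<Rightarrow> real) \<Rightarrow> (real \<times> real) set \<Rightarrow> gfun \<Rightarrow> bool" where
  "joint_pdf M Y Z S g \<longleftrightarrow>
     gfun_nonneg g \<and> gfun_vanishes_outside S g \<and>
     (\<forall>y\<ge>0. \<forall>z\<ge>0. measure M {\<omega> \<in> space M. Y \<omega> \<le> y \<and> Z \<omega> \<le> z} =
        (LINT z':{0..z}|lborel. int_fst (\<lambda>_. 1) g z' 0 y))"

text \<open>
  The family produced by the recurrence, extended by zero outside the domain.
  The index starts at 1; the value at 0 is never used.
\<close>

fun rec_pdf :: "(nat \<Rightarrow> real \<Rightarrow> real) \<Rightarrow> nat \<Rightarrow> gfun" where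
  "rec_pdf f 0 = Ordinary (\<lambda>_ _. 0)"
| "rec_pdf f (Suc 0) = DiagDelta (\<lambda>y z. f 1 y)"
| "rec_pdf f (Suc (Suc m)) = Ordinary (\<lambda>y z.
     if (y, z) \<in> Dom (Suc (Suc m)) then
       f (Suc (Suc m)) z * int_snd (\<lambda>_. 1) (rec_pdf f (Suc m)) (y - z) 0 z
       + int_conv (f (Suc (Suc m))) (rec_pdf f (Suc m)) y z 0 z
     else 0)"

end

theory Submission
  imports Defs
begin

text \<open>
  Since \<open>Y\<^sub>n = Y\<^sub>n\<^sub>-\<^sub>1 + X\<^sub>n\<close> and
  \<open>Z\<^sub>n = max Z\<^sub>n\<^sub>-\<^sub>1 X\<^sub>n\<close>, the recurrence is a change of variables in the
  product law of \<open>((Y\<^sub>n\<^sub>-\<^sub>1, Z\<^sub>n\<^sub>-\<^sub>1), X\<^sub>n)\<close>, split along the null set where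
  \<open>Z\<^sub>n\<^sub>-\<^sub>1 = X\<^sub>n\<close>: on one side the new maximum is \<open>X\<^sub>n\<close>, which gives the first
  integral, and on the other it is \<open>Z\<^sub>n\<^sub>-\<^sub>1\<close>, which gives the second.
  For continuity, the integration limits are shrunk to exactly those points where the integrand's
  argument lies in the previous domain, where the previous density is continuous.  Rescaling the
  integrals to \<open>[0, 1]\<close> then leaves a parametric integral of a jointly continuous function.
\<close>

section \<open>Change of variables for sums and maxima\<close>

lemma nn_integral_lborel_shift:
  fixes c :: real
  assumes "g \<in> borel_measurable borel"
  shows "(\<integral>\<^sup>+u. g u \<partial>lborel) = (\<integral>\<^sup>+y. g (y - c) \<partial>lborel)"
  using nn_integral_real_affine[OF assms, of 1 "- c"] by simp

text \<open>Each section meets the diagonal in a single point, a null set, so the closed half-planes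
  \<open>v <= x\<close> and \<open>x <= v\<close> may both be used despite their overlap. Exchanging
  the integrals on the second half makes the outer variable \<open>z\<close> the larger coordinate
  on both halves, that is, the maximum.\<close>

lemma nn_integral_split_diagonal:
  fixes H :: "real \<Rightarrow> real \<Rightarrow> ennreal"
  assumes [measurable]: "case_prod H \<in> borel_measurable (lborel \<Otimes>\<^sub>M lborel)"
  shows "(\<integral>\<^sup>+x. \<integral>\<^sup>+v. H x v \<partial>lborel \<partial>lborel)
    = (\<integral>\<^sup>+z. (\<integral>\<^sup>+v. H z v * indicator {..z} v \<partial>lborel)
            + (\<integral>\<^sup>+x. H x z * indicator {..z} x \<partial>lborel) \<partial>lborel)"
proof -
  have "(\<integral>\<^sup>+v. H x v \<partial>lborel) = (\<integral>\<^sup>+v. H x v * (if v \<le> x then 1 else 0) \<partial>lborel)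
          + (\<integral>\<^sup>+v. H x v * (if x \<le> v then 1 else 0) \<partial>lborel)" for x
  proof -
    have "AE v in lborel. H x v
        = H x v * (if v \<le> x then 1 else 0) + H x v * (if x \<le> v then 1 else 0)"
      using AE_lborel_singleton[of x]
      by eventually_elim (auto simp: not_le)
    then show ?thesis
      by (subst nn_integral_add[symmetric]) (auto intro!: nn_integral_cong_AE)
  qed
  then have "(\<integral>\<^sup>+x. \<integral>\<^sup>+v. H x v \<partial>lborel \<partial>lborel)
     = (\<integral>\<^sup>+x. \<integral>\<^sup>+v. H x v * (if v \<le> x then 1 else 0) \<partial>lborel \<partial>lborel)
      + (\<integral>\<^sup>+x. \<integral>\<^sup>+v. H x v * (if x \<le> v then 1 else 0) \<partial>lborel \<partial>lborel)"
    by (simp add: nn_integral_add)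
  also have "(\<integral>\<^sup>+x. \<integral>\<^sup>+v. H x v * (if x \<le> v then 1 else 0) \<partial>lborel \<partial>lborel)
      = (\<integral>\<^sup>+z. \<integral>\<^sup>+x. H x z * (if x \<le> z then 1 else 0) \<partial>lborel \<partial>lborel)"
    by (rule lborel_pair.Fubini') measurable
  finally have eq: "(\<integral>\<^sup>+x. \<integral>\<^sup>+v. H x v \<partial>lborel \<partial>lborel)
     = (\<integral>\<^sup>+z. (\<integral>\<^sup>+v. H z v * (if v \<le> z then 1 else 0) \<partial>lborel)
            + (\<integral>\<^sup>+x. H x z * (if x \<le> z then 1 else 0) \<partial>lborel) \<partial>lborel)"
    by (subst nn_integral_add) auto
  show ?thesis
    unfolding eq by (simp add: indicator_def of_bool_def)
qed

text \<open>Reduces a density claim to integrals of indicators, the form in which Fubini and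
  substitution are applied below.\<close>

lemma distributed_eqI:
  assumes [measurable]: "W \<in> measurable M N" "f \<in> borel_measurable N"
    and "\<And>A. A \<in> sets N \<Longrightarrow>
      (\<integral>\<^sup>+\<omega>. indicator A (W \<omega>) \<partial>M) = (\<integral>\<^sup>+x. f x * indicator A x \<partial>N)"
  shows "distributed M N W f"
proof -
  have "distr M N W = density N f"
  proof (rule measure_eqI)
    fix A assume "A \<in> sets (distr M N W)"
    then have A[measurable]: "A \<in> sets N" by simp
    have "emeasure (distr M N W) A = (\<integral>\<^sup>+x. indicator A x \<partial>distr M N W)" by simp
    also have "\<dots> = (\<integral>\<^sup>+\<omega>. indicator A (W \<omega>) \<partial>M)" by (subst nn_integral_distr) auto
    finally show "emeasure (distr M N W) A = emeasure (density N f) A"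
      using A assms(3)[OF A] by (simp add: emeasure_density)
  qed simp
  then show ?thesis by (simp add: distributed_def)
qed

text \<open>This serves \<open>n = 2\<close>, where the preceding pair (\<open>Y\<close>,
  \<open>Z\<close>) lives on the diagonal and has no ordinary density. If one variable is the
  maximum \<open>z\<close> and the sum is \<open>y\<close>, the other one equals
  \<open>y - z\<close>; the two summands record which variable is the larger, and the indicator says
  that \<open>y - z\<close> does not exceed \<open>z\<close>.\<close>

lemma (in prob_space) distributed_add_max:
  fixes a b :: "real \<Rightarrow> ennreal"
  assumes V: "distributed M lborel V b" and X: "distributed M lborel X a"
    and ind: "distr M lborel V \<Otimes>\<^sub>M distr M lborel X = distr M (lborel \<Otimes>\<^sub>M lborel) (\<lambda>\<omega>. (V \<omega>, X \<omega>))"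
  shows "distributed M (lborel \<Otimes>\<^sub>M lborel) (\<lambda>\<omega>. (V \<omega> + X \<omega>, max (V \<omega>) (X \<omega>)))
    (\<lambda>(y, z). (a z * b (y - z) + a (y - z) * b z) * indicator {..z} (y - z))"
proof (rule distributed_eqI)
  have [measurable]: "a \<in> borel_measurable borel" "b \<in> borel_measurable borel"
      "X \<in> borel_measurable M" "V \<in> borel_measurable M"
    using distributed_borel_measurable[OF X] distributed_borel_measurable[OF V]
      distributed_measurable[OF X] distributed_measurable[OF V] by simp_all
  \<comment> \<open>The bound \<open>z\<close> is itself a variable of integration, so the indicator
    is rewritten as a conditional on a measurable comparison before measurability is proved.\<close>
  have ind_if: "indicator {..z} x = (if x \<le> z then 1 else 0 :: ennreal)" for x z :: real
    by (simp add: indicator_def)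
  show "(\<lambda>\<omega>. (V \<omega> + X \<omega>, max (V \<omega>) (X \<omega>))) \<in> measurable M (lborel \<Otimes>\<^sub>M lborel)"
    by measurable
  show "(\<lambda>(y, z). (a z * b (y - z) + a (y - z) * b z) * indicator {..z} (y - z))
      \<in> borel_measurable (lborel \<Otimes>\<^sub>M lborel)"
    unfolding ind_if by measurable
  fix A :: "(real \<times> real) set" assume A[measurable]: "A \<in> sets (lborel \<Otimes>\<^sub>M lborel)"
  let ?F = "\<lambda>y z. indicator A (y, z) :: ennreal"
  have VX: "distributed M (lborel \<Otimes>\<^sub>M lborel) (\<lambda>\<omega>. (V \<omega>, X \<omega>)) (\<lambda>(v, x). b v * a x)"
    by (rule distributed_joint_indep'[OF _ _ V X ind]) (rule lborel.sigma_finite_measure_axioms)+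
  have "(\<integral>\<^sup>+\<omega>. indicator A (V \<omega> + X \<omega>, max (V \<omega>) (X \<omega>)) \<partial>M)
     = (\<integral>\<^sup>+p. (case p of (v, x) \<Rightarrow> b v * a x) * ?F (fst p + snd p) (max (fst p) (snd p)) \<partial>(lborel \<Otimes>\<^sub>M lborel))"
    by (subst distributed_nn_integral[OF VX]) auto
  also have "\<dots> = (\<integral>\<^sup>+x. \<integral>\<^sup>+v. b v * a x * ?F (v + x) (max v x) \<partial>lborel \<partial>lborel)"
    by (subst lborel_pair.nn_integral_snd[symmetric]) auto
  also have "\<dots> = (\<integral>\<^sup>+z. (\<integral>\<^sup>+v. b v * a z * ?F (v + z) (max v z) * indicator {..z} v \<partial>lborel)
       + (\<integral>\<^sup>+x. b z * a x * ?F (z + x) (max z x) * indicator {..z} x \<partial>lborel) \<partial>lborel)"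
    by (rule nn_integral_split_diagonal) measurable
  also have "\<dots> = (\<integral>\<^sup>+z. \<integral>\<^sup>+y. (a z * b (y - z) + a (y - z) * b z) * indicator {..z} (y - z) * ?F y z \<partial>lborel \<partial>lborel)"
  proof (rule nn_integral_cong)
    fix z :: real
    \<comment> \<open>For fixed \<open>z\<close>, the shift \<open>v = y - z\<close> turns the sum
      \<open>v + z\<close> into \<open>y\<close>, and \<open>v <= z\<close> turns the maximum into
      \<open>z\<close>.\<close>
    have "(\<integral>\<^sup>+v. b v * a z * ?F (v + z) (max v z) * indicator {..z} v \<partial>lborel)
        = (\<integral>\<^sup>+y. b (y - z) * a z * ?F y z * indicator {..z} (y - z) \<partial>lborel)"
      by (subst nn_integral_lborel_shift[where c=z])
         (auto simp: ind_if max_def intro!: nn_integral_cong)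
    moreover have "(\<integral>\<^sup>+x. b z * a x * ?F (z + x) (max z x) * indicator {..z} x \<partial>lborel)
        = (\<integral>\<^sup>+y. b z * a (y - z) * ?F y z * indicator {..z} (y - z) \<partial>lborel)"
      by (subst nn_integral_lborel_shift[where c=z])
         (auto simp: ind_if max_def intro!: nn_integral_cong)
    ultimately show "(\<integral>\<^sup>+v. b v * a z * ?F (v + z) (max v z) * indicator {..z} v \<partial>lborel)
       + (\<integral>\<^sup>+x. b z * a x * ?F (z + x) (max z x) * indicator {..z} x \<partial>lborel)
       = (\<integral>\<^sup>+y. (a z * b (y - z) + a (y - z) * b z) * indicator {..z} (y - z) * ?F y z \<partial>lborel)"
      unfolding ind_if
      by (simp add: nn_integral_add[symmetric])
         (auto simp: algebra_simps intro!: nn_integral_cong)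
  qed
  also have "\<dots> = (\<integral>\<^sup>+p. (case p of (y, z) \<Rightarrow> (a z * b (y - z) + a (y - z) * b z) * indicator {..z} (y - z)) * indicator A p \<partial>(lborel \<Otimes>\<^sub>M lborel))"
    unfolding ind_if by (subst lborel_pair.nn_integral_snd[symmetric]) (auto simp: split_beta')
  finally show "(\<integral>\<^sup>+\<omega>. indicator A (V \<omega> + X \<omega>, max (V \<omega>) (X \<omega>)) \<partial>M) = \<dots>" .
qed

text \<open>Measurable images of independent variables are independent, since pushing forward each
  factor of a product law pushes forward the product. The result has the shape of the hypothesis
  \<open>ind\<close> in the two density lemmas, with free target spaces so that
  \<open>lborel\<close> fits.\<close>

lemma (in prob_space) indep_var_distr_Pair:
  assumes ind: "indep_var A U B V"
    and [measurable]: "g \<in> measurable A S" "k \<in> measurable B T"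
  shows "distr M S (\<lambda>\<omega>. g (U \<omega>)) \<Otimes>\<^sub>M distr M T (\<lambda>\<omega>. k (V \<omega>))
    = distr M (S \<Otimes>\<^sub>M T) (\<lambda>\<omega>. (g (U \<omega>), k (V \<omega>)))"
proof -
  have [measurable]: "U \<in> measurable M A" "V \<in> measurable M B"
    and eq: "distr M A U \<Otimes>\<^sub>M distr M B V = distr M (A \<Otimes>\<^sub>M B) (\<lambda>\<omega>. (U \<omega>, V \<omega>))"
    using ind by (simp_all add: indep_var_distribution_eq)
  have "distr M S (\<lambda>\<omega>. g (U \<omega>)) \<Otimes>\<^sub>M distr M T (\<lambda>\<omega>. k (V \<omega>))
      = distr (distr M A U) S g \<Otimes>\<^sub>M distr (distr M B V) T k"
    by (simp add: distr_distr comp_def)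
  also have "\<dots> = distr (distr M A U \<Otimes>\<^sub>M distr M B V) (S \<Otimes>\<^sub>M T) (\<lambda>(x, y). (g x, k y))"
  proof (rule pair_measure_distr)
    have "prob_space (distr (distr M B V) T k)"
      by (simp add: distr_distr prob_space_distr)
    then show "sigma_finite_measure (distr (distr M B V) T k)"
      by (rule prob_space_imp_sigma_finite)
  qed simp_all
  also have "\<dots> = distr M (S \<Otimes>\<^sub>M T) (\<lambda>\<omega>. (g (U \<omega>), k (V \<omega>)))"
    unfolding eq by (simp add: distr_distr comp_def)
  finally show ?thesis .
qed

text \<open>One recurrence step at the level of extended nonnegative integrals. The maximum no
  longer determines the sum, so the sum is substituted first with \<open>v\<close> and
  \<open>x\<close> fixed; the plane of (\<open>x\<close>, \<open>v\<close>) is then split along its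
  diagonal for each fixed value \<open>y\<close> of the sum. The integrals run over
  \<open>{..z}\<close> because no sign condition is imposed here.\<close>

lemma (in prob_space) distributed_pair_add_max:
  fixes a :: "real \<Rightarrow> ennreal" and r :: "real \<times> real \<Rightarrow> ennreal"
  assumes W: "distributed M (lborel \<Otimes>\<^sub>M lborel) (\<lambda>\<omega>. (Y \<omega>, Z \<omega>)) r"
    and X: "distributed M lborel X a"
    and ind: "distr M (lborel \<Otimes>\<^sub>M lborel) (\<lambda>\<omega>. (Y \<omega>, Z \<omega>)) \<Otimes>\<^sub>M distr M lborel X
      = distr M ((lborel \<Otimes>\<^sub>M lborel) \<Otimes>\<^sub>M lborel) (\<lambda>\<omega>. ((Y \<omega>, Z \<omega>), X \<omega>))"
  shows "distributed M (lborel \<Otimes>\<^sub>M lborel) (\<lambda>\<omega>. (Y \<omega> + X \<omega>, max (Z \<omega>) (X \<omega>)))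
    (\<lambda>(y, z). a z * (\<integral>\<^sup>+v. r (y - z, v) * indicator {..z} v \<partial>lborel)
            + (\<integral>\<^sup>+x. a x * r (y - x, z) * indicator {..z} x \<partial>lborel))"
    (is "distributed _ _ _ ?h")
proof (rule distributed_eqI)
  have a[measurable]: "a \<in> borel_measurable borel" and X'[measurable]: "X \<in> borel_measurable M"
    using distributed_borel_measurable[OF X] distributed_measurable[OF X] by simp_all
  have r[measurable]: "r \<in> borel_measurable (lborel \<Otimes>\<^sub>M lborel)"
    using distributed_borel_measurable[OF W] .
  have W': "(\<lambda>\<omega>. (Y \<omega>, Z \<omega>)) \<in> measurable M (lborel \<Otimes>\<^sub>M lborel)"
    using distributed_measurable[OF W] .
  have [measurable]: "Y \<in> borel_measurable M" "Z \<in> borel_measurable M"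
    using measurable_compose[OF W' measurable_fst] measurable_compose[OF W' measurable_snd]
    by (simp_all add: comp_def)
  have ind_if: "indicator {..z} x = (if x \<le> z then 1 else 0 :: ennreal)" for x z :: real
    by (simp add: indicator_def)
  show "(\<lambda>\<omega>. (Y \<omega> + X \<omega>, max (Z \<omega>) (X \<omega>))) \<in> measurable M (lborel \<Otimes>\<^sub>M lborel)"
    by measurable
  show h[measurable]: "?h \<in> borel_measurable (lborel \<Otimes>\<^sub>M lborel)"
    unfolding ind_if by measurable
  fix A :: "(real \<times> real) set" assume A[measurable]: "A \<in> sets (lborel \<Otimes>\<^sub>M lborel)"
  let ?F = "\<lambda>y z. indicator A (y, z) :: ennreal"
  interpret LL: pair_sigma_finite "lborel \<Otimes>\<^sub>M lborel :: (real \<times> real) measure" "lborel :: real measure"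
    by (simp add: pair_sigma_finite_def lborel_pair.sigma_finite_measure_axioms lborel.sigma_finite_measure_axioms)
  have WX: "distributed M ((lborel \<Otimes>\<^sub>M lborel) \<Otimes>\<^sub>M lborel) (\<lambda>\<omega>. ((Y \<omega>, Z \<omega>), X \<omega>)) (\<lambda>(w, x). r w * a x)"
    by (rule distributed_joint_indep'[OF _ _ W X ind])
       (rule lborel_pair.sigma_finite_measure_axioms lborel.sigma_finite_measure_axioms)+
  have [measurable]: "(\<lambda>p :: (real \<times> real) \<times> real. (fst (fst p) + snd p, max (snd (fst p)) (snd p)))
      \<in> measurable ((lborel \<Otimes>\<^sub>M lborel) \<Otimes>\<^sub>M lborel) (lborel \<Otimes>\<^sub>M lborel)"
    by measurable
  have F[measurable]: "(\<lambda>p. ?F (fst (fst p) + snd p) (max (snd (fst p)) (snd p)))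
      \<in> borel_measurable ((lborel \<Otimes>\<^sub>M lborel) \<Otimes>\<^sub>M lborel)"
    by measurable
  have "(\<integral>\<^sup>+\<omega>. indicator A (Y \<omega> + X \<omega>, max (Z \<omega>) (X \<omega>)) \<partial>M)
     = (\<integral>\<^sup>+p. (case p of (w, x) \<Rightarrow> r w * a x) * ?F (fst (fst p) + snd p) (max (snd (fst p)) (snd p))
          \<partial>((lborel \<Otimes>\<^sub>M lborel) \<Otimes>\<^sub>M lborel))"
    by (subst distributed_nn_integral[OF WX, where g="\<lambda>p. ?F (fst (fst p) + snd p) (max (snd (fst p)) (snd p))"])
       (use F in simp_all)
  also have "\<dots> = (\<integral>\<^sup>+x. \<integral>\<^sup>+w. r w * a x * ?F (fst w + x) (max (snd w) x) \<partial>(lborel \<Otimes>\<^sub>M lborel) \<partial>lborel)"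
    by (subst LL.nn_integral_snd[symmetric]) auto
  also have "\<dots> = (\<integral>\<^sup>+x. \<integral>\<^sup>+v. \<integral>\<^sup>+u. r (u, v) * a x * ?F (u + x) (max v x) \<partial>lborel \<partial>lborel \<partial>lborel)"
    by (subst lborel_pair.nn_integral_snd[symmetric]) auto
  also have "\<dots> = (\<integral>\<^sup>+x. \<integral>\<^sup>+v. \<integral>\<^sup>+y. r (y - x, v) * a x * ?F y (max v x) \<partial>lborel \<partial>lborel \<partial>lborel)"
  proof (rule nn_integral_cong, rule nn_integral_cong)
    fix x v :: real
    show "(\<integral>\<^sup>+u. r (u, v) * a x * ?F (u + x) (max v x) \<partial>lborel)
        = (\<integral>\<^sup>+y. r (y - x, v) * a x * ?F y (max v x) \<partial>lborel)"
      by (subst nn_integral_lborel_shift[where c=x]) auto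
  qed
  \<comment> \<open>Two exchanges bring \<open>y\<close> outermost and leave \<open>x\<close> and
    \<open>v\<close> inside, ready for the split along the diagonal.\<close>
  also have "\<dots> = (\<integral>\<^sup>+x. \<integral>\<^sup>+y. \<integral>\<^sup>+v. r (y - x, v) * a x * ?F y (max v x) \<partial>lborel \<partial>lborel \<partial>lborel)"
    by (rule nn_integral_cong, rule lborel_pair.Fubini') measurable
  also have "\<dots> = (\<integral>\<^sup>+y. \<integral>\<^sup>+x. \<integral>\<^sup>+v. r (y - x, v) * a x * ?F y (max v x) \<partial>lborel \<partial>lborel \<partial>lborel)"
    by (rule lborel_pair.Fubini') measurable
  also have "\<dots> = (\<integral>\<^sup>+y. \<integral>\<^sup>+z. ?h (y, z) * ?F y z \<partial>lborel \<partial>lborel)"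
  proof (rule nn_integral_cong)
    fix y :: real
    have "(\<integral>\<^sup>+x. \<integral>\<^sup>+v. r (y - x, v) * a x * ?F y (max v x) \<partial>lborel \<partial>lborel)
      = (\<integral>\<^sup>+z. (\<integral>\<^sup>+v. r (y - z, v) * a z * ?F y (max v z) * indicator {..z} v \<partial>lborel)
          + (\<integral>\<^sup>+x. r (y - x, z) * a x * ?F y (max z x) * indicator {..z} x \<partial>lborel) \<partial>lborel)"
      by (rule nn_integral_split_diagonal) measurable
    also have "\<dots> = (\<integral>\<^sup>+z. ?h (y, z) * ?F y z \<partial>lborel)"
    proof (rule nn_integral_cong)
      fix z :: real
      \<comment> \<open>On \<open>v <= z\<close> the maximum is \<open>z\<close>, so the indicator
        of \<open>A\<close> no longer depends on \<open>v\<close> and leaves the integral; the other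
        half is treated alike.\<close>
      have "(\<integral>\<^sup>+v. r (y - z, v) * a z * ?F y (max v z) * indicator {..z} v \<partial>lborel)
          = (\<integral>\<^sup>+v. (a z * ?F y z) * (r (y - z, v) * indicator {..z} v) \<partial>lborel)"
        by (intro nn_integral_cong) (auto simp: ind_if max_def mult_ac)
      also have "\<dots> = (a z * ?F y z) * (\<integral>\<^sup>+v. r (y - z, v) * indicator {..z} v \<partial>lborel)"
        unfolding ind_if by (rule nn_integral_cmult) measurable
      finally have 1: "(\<integral>\<^sup>+v. r (y - z, v) * a z * ?F y (max v z) * indicator {..z} v \<partial>lborel) = \<dots>" .
      have "(\<integral>\<^sup>+x. r (y - x, z) * a x * ?F y (max z x) * indicator {..z} x \<partial>lborel)
          = (\<integral>\<^sup>+x. ?F y z * (a x * r (y - x, z) * indicator {..z} x) \<partial>lborel)"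
        by (intro nn_integral_cong) (auto simp: ind_if max_def mult_ac)
      also have "\<dots> = ?F y z * (\<integral>\<^sup>+x. a x * r (y - x, z) * indicator {..z} x \<partial>lborel)"
        unfolding ind_if by (rule nn_integral_cmult) measurable
      finally have 2: "(\<integral>\<^sup>+x. r (y - x, z) * a x * ?F y (max z x) * indicator {..z} x \<partial>lborel) = \<dots>" .
      show "(\<integral>\<^sup>+v. r (y - z, v) * a z * ?F y (max v z) * indicator {..z} v \<partial>lborel)
          + (\<integral>\<^sup>+x. r (y - x, z) * a x * ?F y (max z x) * indicator {..z} x \<partial>lborel)
          = ?h (y, z) * ?F y z"
        unfolding 1 2 by (simp add: algebra_simps)
    qed
    finally show "(\<integral>\<^sup>+x. \<integral>\<^sup>+v. r (y - x, v) * a x * ?F y (max v x) \<partial>lborel \<partial>lborel)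
      = (\<integral>\<^sup>+z. ?h (y, z) * ?F y z \<partial>lborel)" .
  qed
  also have "\<dots> = (\<integral>\<^sup>+p. ?h p * indicator A p \<partial>(lborel \<Otimes>\<^sub>M lborel))"
    by (rule lborel.nn_integral_fst) measurable
  finally show "(\<integral>\<^sup>+\<omega>. indicator A (Y \<omega> + X \<omega>, max (Z \<omega>) (X \<omega>)) \<partial>M) = \<dots>" .
qed

section \<open>Parametric integrals and restriction to intervals\<close>

text \<open>The substitution \<open>x = l p + (u p - l p) * t\<close> fixes the interval of
  integration, and its values stay between \<open>l p\<close> and \<open>u p\<close>, so continuity
  of \<open>\<phi>\<close> on the closed region between the limits suffices. No extension of
  \<open>\<phi>\<close> beyond that region is required.\<close>

lemma continuous_on_integral_moving_limits:
  fixes \<phi> :: "'p::topological_space \<Rightarrow> real \<Rightarrow> real"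
  assumes l: "continuous_on D l" and u: "continuous_on D u"
    and lu: "\<And>p. p \<in> D \<Longrightarrow> l p \<le> u p"
    and \<phi>: "continuous_on {(p, x). p \<in> D \<and> l p \<le> x \<and> x \<le> u p} (\<lambda>(p, x). \<phi> p x)"
  shows "continuous_on D (\<lambda>p. LINT x:{l p..u p}|lborel. \<phi> p x)"
proof -
  let ?\<psi> = "\<lambda>p t. \<phi> p (l p + (u p - l p) * t)"
  have \<psi>: "continuous_on (D \<times> cbox 0 1) (\<lambda>(p, t). ?\<psi> p t)"
  proof -
    have "continuous_on (D \<times> cbox 0 1) (\<lambda>q. (fst q, l (fst q) + (u (fst q) - l (fst q)) * snd q))"
      by (intro continuous_intros continuous_on_compose2[OF l] continuous_on_compose2[OF u]) auto
    moreover have "(\<lambda>q. (fst q, l (fst q) + (u (fst q) - l (fst q)) * snd q)) ` (D \<times> cbox 0 1)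
        \<subseteq> {(p, x). p \<in> D \<and> l p \<le> x \<and> x \<le> u p}"
    proof -
      have "l p + (u p - l p) * t \<le> u p" if "p \<in> D" "t \<le> 1" for p t
        using mult_left_mono[of t 1 "u p - l p"] lu that by simp
      then show ?thesis using lu by auto
    qed
    ultimately have "continuous_on (D \<times> cbox 0 1)
        (\<lambda>q. (\<lambda>(p, x). \<phi> p x) (fst q, l (fst q) + (u (fst q) - l (fst q)) * snd q))"
      by (rule continuous_on_compose2[OF \<phi>])
    then show ?thesis by (simp add: split_beta')
  qed
  have "(LINT x:{l p..u p}|lborel. \<phi> p x) = (u p - l p) * integral (cbox 0 1) (?\<psi> p)"
    if p: "p \<in> D" for p
  \<comment> \<open>A degenerate interval must be treated apart, because the affine substitution is
    then not invertible; both sides are 0.\<close>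
  proof (cases "l p = u p")
    case True
    have "AE x in lborel. indicator {l p..u p} x *\<^sub>R \<phi> p x = 0"
      using AE_lborel_singleton[of "l p"] by eventually_elim (use True in auto)
    then have "(LINT x:{l p..u p}|lborel. \<phi> p x) = 0"
      unfolding set_lebesgue_integral_def by (rule integral_eq_zero_AE)
    with True show ?thesis by simp
  next
    case False
    with lu[OF p] have c: "0 < u p - l p" by simp
    have "continuous_on (cbox 0 1) (?\<psi> p)"
      using continuous_on_compose2[OF \<psi>, of "cbox 0 1" "\<lambda>t. (p, t)"] p
      by (force intro: continuous_on_Pair continuous_on_const continuous_on_id)
    then have "(LINT t:{0..1}|lborel. ?\<psi> p t) = integral (cbox 0 1) (?\<psi> p)"
      by (subst set_borel_integral_eq_integral(2)) (auto intro!: borel_integrable_atLeastAtMost')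
    moreover have "indicator {l p..u p} (l p + (u p - l p) * t) = (indicator {0..1} t :: real)" for t
    proof -
      have "l p + (u p - l p) * t \<le> u p \<longleftrightarrow> (u p - l p) * t \<le> (u p - l p) * 1"
        by auto
      also have "\<dots> \<longleftrightarrow> t \<le> 1"
        using c by (rule mult_le_cancel_left_pos)
      finally have "l p + (u p - l p) * t \<le> u p \<longleftrightarrow> t \<le> 1" .
      moreover have "0 \<le> (u p - l p) * t \<longleftrightarrow> 0 \<le> t"
        using c by (simp add: zero_le_mult_iff)
      ultimately show ?thesis by (simp add: indicator_def)
    qed
    ultimately show ?thesis
      using c unfolding set_lebesgue_integral_def
      by (subst lborel_integral_real_affine[where c="u p - l p" and t="l p"]) auto
  qed
  moreover have "continuous_on D (\<lambda>p. (u p - l p) * integral (cbox 0 1) (?\<psi> p))"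
    by (intro continuous_intros l u integral_continuous_on_param \<psi>)
  ultimately show ?thesis by simp
qed

lemma set_integral_restrict:
  fixes \<phi> :: "real \<Rightarrow> real"
  assumes "W \<subseteq> S" and "\<And>x. x \<in> S - W \<Longrightarrow> \<phi> x = 0"
  shows "(LINT x:S|lborel. \<phi> x) = (LINT x:W|lborel. \<phi> x)"
  unfolding set_lebesgue_integral_def
  by (rule Bochner_Integration.integral_cong) (use assms in \<open>auto simp: indicator_def\<close>)

text \<open>The bridge from extended nonnegative integrals to real ones: continuity on a compact
  interval that carries the integrand gives integrability there, hence a finite value.\<close>

lemma nn_integral_eq_set_integral_Icc:
  fixes \<phi> :: "real \<Rightarrow> real"
  assumes "{l..u} \<subseteq> S" and "\<And>x. x \<in> S - {l..u} \<Longrightarrow> \<phi> x = 0"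
    and "continuous_on {l..u} \<phi>" and nonneg: "\<And>x. 0 \<le> \<phi> x"
  shows "(\<integral>\<^sup>+x. ennreal (\<phi> x) * indicator S x \<partial>lborel) = ennreal (LINT x:{l..u}|lborel. \<phi> x)"
proof -
  have "(\<integral>\<^sup>+x. ennreal (\<phi> x) * indicator S x \<partial>lborel)
      = (\<integral>\<^sup>+x. ennreal (indicator {l..u} x *\<^sub>R \<phi> x) \<partial>lborel)"
    by (rule nn_integral_cong) (use assms in \<open>auto simp: indicator_def\<close>)
  also have "\<dots> = ennreal (LINT x:{l..u}|lborel. \<phi> x)"
    unfolding set_lebesgue_integral_def
    using borel_integrable_atLeastAtMost'[OF assms(3)] nonneg
    by (intro nn_integral_eq_integral) (auto simp: set_integrable_def)
  finally show ?thesis .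
qed

section \<open>Sections of the domains\<close>

text \<open>Membership of \<open>(y - z, x)\<close> in \<open>Dom m\<close> amounts to
  \<open>x <= y - z <= m x\<close>; solving for \<open>x\<close> and adding \<open>x <= z\<close>
  gives the limits of the first integral.\<close>

lemma Dom_fst_window:
  assumes "1 \<le> m" "(y, z) \<in> Dom (Suc m)"
  shows "{(y - z) / real m..min (y - z) z} = {x \<in> {0..z}. (y - z, x) \<in> Dom m}"
proof -
  have "0 \<le> (y - z) / real m" using assms by (simp add: Dom_def)
  then have "0 \<le> x" if "(y - z) / real m \<le> x" for x using that by linarith
  then show ?thesis using assms by (auto simp: Dom_def field_simps)
qed

text \<open>Here membership amounts to \<open>z <= y - x <= m z\<close>, which bounds
  \<open>x\<close> by \<open>y - m z\<close> and \<open>y - z\<close>.\<close>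

lemma Dom_conv_window:
  assumes "1 \<le> m" "(y, z) \<in> Dom (Suc m)"
  shows "{max (y - real m * z) 0..min (y - z) z} = {x \<in> {0..z}. (y - x, z) \<in> Dom m}"
  using assms by (auto simp: Dom_def field_simps)

text \<open>Together with \<open>Dom_SucI_conv\<close>, used in contrapositive form: at a point
  outside \<open>Dom (Suc m)\<close> neither integrand meets \<open>Dom m\<close>, so both integrals
  vanish.\<close>

lemma Dom_SucI_fst:
  assumes "(y - z, x) \<in> Dom m" "x \<le> z"
  shows "(y, z) \<in> Dom (Suc m)"
proof -
  have "real m * x \<le> real m * z" using assms by (simp add: mult_left_mono)
  then show ?thesis using assms by (auto simp: Dom_def algebra_simps)
qed

lemma Dom_SucI_conv:
  assumes "(y - x, z) \<in> Dom m" "0 \<le> x" "x \<le> z"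
  shows "(y, z) \<in> Dom (Suc m)"
  using assms by (auto simp: Dom_def algebra_simps)

section \<open>One recurrence step for an ordinary density\<close>

text \<open>The last clause of \<open>rec_pdf\<close> for an ordinary predecessor, detached from the
  recursion so that the step can be studied for an abstract density \<open>r\<close>.\<close>

definition step_pdf :: "nat \<Rightarrow> (real \<Rightarrow> real) \<Rightarrow> (real \<Rightarrow> real \<Rightarrow> real) \<Rightarrow> real \<Rightarrow> real \<Rightarrow> real" where
  "step_pdf m a r y z = (if (y, z) \<in> Dom (Suc m) then
     a z * (LINT x:{0..z}|lborel. r (y - z) x) + (LINT x:{0..z}|lborel. a x * r (y - x) z) else 0)"

text \<open>The conditions on \<open>r\<close> are the induction invariant: nonnegativity, vanishing
  outside \<open>Dom m\<close> and continuity on it. Each is recovered for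
  \<open>step_pdf m a r\<close> with respect to \<open>Dom (Suc m)\<close>.\<close>

locale recurrence_step =
  fixes m :: nat and a :: "real \<Rightarrow> real" and r :: "real \<Rightarrow> real \<Rightarrow> real"
  assumes m: "1 \<le> m"
    and a_nonneg: "\<And>x. 0 \<le> a x" and a_cont: "continuous_on {0..} a"
    and a_neg: "\<And>x. x < 0 \<Longrightarrow> a x = 0"
    and r_nonneg: "\<And>y z. 0 \<le> r y z" and r_outside: "\<And>y z. (y, z) \<notin> Dom m \<Longrightarrow> r y z = 0"
    and r_cont: "continuous_on (Dom m) (\<lambda>(y, z). r y z)"
begin

lemma step_fst_window:
  assumes "(y, z) \<in> Dom (Suc m)"
  shows "(LINT x:{0..z}|lborel. r (y - z) x)
    = (LINT x:{(y - z) / real m..min (y - z) z}|lborel. r (y - z) x)"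
  unfolding Dom_fst_window[OF m assms]
  by (rule set_integral_restrict) (use r_outside in auto)

lemma step_conv_window:
  assumes "(y, z) \<in> Dom (Suc m)"
  shows "(LINT x:{0..z}|lborel. a x * r (y - x) z)
    = (LINT x:{max (y - real m * z) 0..min (y - z) z}|lborel. a x * r (y - x) z)"
  unfolding Dom_conv_window[OF m assms]
  by (rule set_integral_restrict) (use r_outside in auto)

lemma step_pdf_nonneg: "0 \<le> step_pdf m a r y z"
  unfolding step_pdf_def set_lebesgue_integral_def
  by (auto intro!: add_nonneg_nonneg mult_nonneg_nonneg Bochner_Integration.integral_nonneg a_nonneg r_nonneg)

lemma continuous_on_step_pdf: "continuous_on (Dom (Suc m)) (\<lambda>(y, z). step_pdf m a r y z)"
proof -
  let ?D = "Dom (Suc m)"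
  have mpos: "real m > 0" using m by simp
  have ne: "real m \<noteq> 0" using m by simp
  \<comment> \<open>The window must be nonempty: \<open>(y - z) / m <= z\<close> restates
    \<open>y <= (m + 1) z\<close>, and \<open>(y - z) / m <= y - z\<close> follows from
    \<open>0 <= y - z\<close> and \<open>1 <= m\<close>.\<close>
  have fst_le: "(y - z) / real m \<le> min (y - z) z" if "(y, z) \<in> ?D" for y z
  proof -
    have "y - z \<le> (y - z) * real m" using that m by (simp add: Dom_def mult_le_cancel_left1)
    then show ?thesis using that mpos by (simp add: Dom_def field_simps)
  qed
  \<comment> \<open>Again \<open>y - m z <= z\<close> restates \<open>y <= (m + 1) z\<close>, while
    \<open>y - m z <= y - z\<close> follows from \<open>1 <= m\<close> and
    \<open>0 <= z\<close>.\<close>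
  have conv_le: "max (y - real m * z) 0 \<le> min (y - z) z" if "(y, z) \<in> ?D" for y z
  proof -
    have "z \<le> real m * z" using that m by (simp add: Dom_def mult_le_cancel_right1)
    then show ?thesis using that unfolding Dom_def by (auto simp: algebra_simps max_def min_def)
  qed
  have 1: "continuous_on ?D (\<lambda>p. LINT x:{(fst p - snd p) / real m..min (fst p - snd p) (snd p)}|lborel.
      r (fst p - snd p) x)"
  proof (rule continuous_on_integral_moving_limits)
    show "continuous_on {(p, x). p \<in> ?D \<and> (fst p - snd p) / real m \<le> x \<and> x \<le> min (fst p - snd p) (snd p)}
        (\<lambda>(p, x). r (fst p - snd p) x)" (is "continuous_on ?K _")
    proof -
      have "(\<lambda>q. (fst (fst q) - snd (fst q), snd q)) ` ?K \<subseteq> Dom m"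
        using Dom_fst_window[OF m] by fastforce
      then have "continuous_on ?K (\<lambda>q. (\<lambda>(y, z). r y z) (fst (fst q) - snd (fst q), snd q))"
        by (intro continuous_on_compose2[OF r_cont] continuous_intros) auto
      then show ?thesis by (simp add: split_beta')
    qed
  qed (use fst_le ne in \<open>auto intro!: continuous_intros\<close>)
  have 2: "continuous_on ?D (\<lambda>p. LINT x:{max (fst p - real m * snd p) 0..min (fst p - snd p) (snd p)}|lborel.
      a x * r (fst p - x) (snd p))"
  proof (rule continuous_on_integral_moving_limits)
    show "continuous_on {(p, x). p \<in> ?D \<and> max (fst p - real m * snd p) 0 \<le> x \<and> x \<le> min (fst p - snd p) (snd p)}
        (\<lambda>(p, x). a x * r (fst p - x) (snd p))" (is "continuous_on ?K _")
    proof -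
      have "(\<lambda>q. (fst (fst q) - snd q, snd (fst q))) ` ?K \<subseteq> Dom m"
        using Dom_conv_window[OF m] by fastforce
      then have "continuous_on ?K (\<lambda>q. a (snd q) * (\<lambda>(y, z). r y z) (fst (fst q) - snd q, snd (fst q)))"
        by (intro continuous_on_mult continuous_on_compose2[OF r_cont] continuous_on_compose2[OF a_cont]
            continuous_intros) auto
      then show ?thesis by (simp add: split_beta')
    qed
  qed (use conv_le in \<open>auto intro!: continuous_intros\<close>)
  have "continuous_on ?D (\<lambda>p. a (snd p) * (LINT x:{(fst p - snd p) / real m..min (fst p - snd p) (snd p)}|lborel.
      r (fst p - snd p) x)
     + (LINT x:{max (fst p - real m * snd p) 0..min (fst p - snd p) (snd p)}|lborel. a x * r (fst p - x) (snd p)))"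
    by (intro continuous_on_add continuous_on_mult 1 2 continuous_on_compose2[OF a_cont] continuous_intros)
       (auto simp: Dom_def)
  then show ?thesis
    by (rule continuous_on_eq) (auto simp: step_pdf_def step_fst_window step_conv_window)
qed

text \<open>Identifies the density found by \<open>distributed_pair_add_max\<close> with the
  real-valued recurrence. Inside the domain both integrals reduce to compact windows; outside it
  both integrands are identically zero.\<close>

lemma ennreal_step_pdf:
  "ennreal (step_pdf m a r y z)
    = ennreal (a z) * (\<integral>\<^sup>+v. ennreal (r (y - z) v) * indicator {..z} v \<partial>lborel)
    + (\<integral>\<^sup>+x. ennreal (a x) * ennreal (r (y - x) z) * indicator {..z} x \<partial>lborel)"
proof (cases "(y, z) \<in> Dom (Suc m)")
  case True
  note W = Dom_fst_window[OF m True] Dom_conv_window[OF m True]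
  have "(\<integral>\<^sup>+v. ennreal (r (y - z) v) * indicator {..z} v \<partial>lborel)
      = ennreal (LINT x:{(y - z) / real m..min (y - z) z}|lborel. r (y - z) x)"
  proof (rule nn_integral_eq_set_integral_Icc)
    have "continuous_on {(y - z) / real m..min (y - z) z} (\<lambda>x. (\<lambda>(y, z). r y z) (y - z, x))"
      by (intro continuous_on_compose2[OF r_cont] continuous_intros) (use W in auto)
    then show "continuous_on {(y - z) / real m..min (y - z) z} (r (y - z))" by simp
    show "r (y - z) x = 0" if "x \<in> {..z} - {(y - z) / real m..min (y - z) z}" for x
      using that W by (intro r_outside) (auto simp: Dom_def)
  qed (use r_nonneg in auto)
  moreover have "(\<integral>\<^sup>+x. ennreal (a x * r (y - x) z) * indicator {..z} x \<partial>lborel)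
      = ennreal (LINT x:{max (y - real m * z) 0..min (y - z) z}|lborel. a x * r (y - x) z)"
  proof (rule nn_integral_eq_set_integral_Icc)
    have "continuous_on {max (y - real m * z) 0..min (y - z) z} (\<lambda>x. a x * (\<lambda>(y, z). r y z) (y - x, z))"
      by (intro continuous_on_mult continuous_on_compose2[OF r_cont] continuous_on_compose2[OF a_cont]
          continuous_intros) (use W in auto)
    then show "continuous_on {max (y - real m * z) 0..min (y - z) z} (\<lambda>x. a x * r (y - x) z)" by simp
    show "a x * r (y - x) z = 0" if "x \<in> {..z} - {max (y - real m * z) 0..min (y - z) z}" for x
    \<comment> \<open>For negative \<open>x\<close> the point \<open>(y - x, z)\<close> may well lie
      in \<open>Dom m\<close>; there the vanishing of \<open>a\<close> is what removes the half-line
      below 0.\<close>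
    proof (cases "x < 0")
      case False
      then have "(y - x, z) \<notin> Dom m" using that W by auto
      then show ?thesis by (simp add: r_outside)
    qed (simp add: a_neg)
  qed (use r_nonneg a_nonneg in auto)
  moreover have "0 \<le> (LINT x:S|lborel. r (y - z) x)" "0 \<le> (LINT x:S|lborel. a x * r (y - x) z)" for S
    unfolding set_lebesgue_integral_def
    by (auto intro!: Bochner_Integration.integral_nonneg mult_nonneg_nonneg a_nonneg r_nonneg)
  ultimately show ?thesis
    using True a_nonneg r_nonneg
    by (simp add: step_pdf_def step_fst_window step_conv_window ennreal_plus ennreal_mult[symmetric])
next
  case False
  have 1: "ennreal (r (y - z) v) * indicator {..z} v = 0" for v
    using False Dom_SucI_fst[of y z v m] r_outside[of "y - z" v] by (cases "v \<le> z"; cases "(y - z, v) \<in> Dom m") auto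
  have 2: "ennreal (a x) * ennreal (r (y - x) z) * indicator {..z} x = 0" for x
    using False Dom_SucI_conv[of y x z m] r_outside[of "y - x" z] a_neg[of x]
    by (cases "x < 0"; cases "x \<le> z"; cases "(y - x, z) \<in> Dom m") auto
  show ?thesis using False unfolding 1 2 by (simp add: step_pdf_def)
qed

end

section \<open>Partial sums, partial maxima and independence\<close>

lemma partial_sum_Suc: "partial_sum X (Suc n) \<omega> = partial_sum X n \<omega> + X (Suc n) \<omega>"
  by (simp add: partial_sum_def)

lemma partial_max_Suc:
  assumes "1 \<le> n"
  shows "partial_max X (Suc n) \<omega> = max (partial_max X n \<omega>) (X (Suc n) \<omega>)"
proof -
  have "(\<lambda>i. X i \<omega>) ` {1..Suc n} = insert (X (Suc n) \<omega>) ((\<lambda>i. X i \<omega>) ` {1..n})"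
    by (simp add: atLeastAtMostSuc_conv)
  then show ?thesis
    using assms by (simp add: partial_max_def max.commute)
qed

text \<open>The pair and the new variable are measurable functions of the disjoint coordinate blocks
  \<open>{1..n}\<close> and \<open>{Suc n}\<close>, which are independent.\<close>

lemma (in prob_space) indep_partial_sum_max:
  assumes "indep_vars (\<lambda>_. borel) X {1..}" and n: "1 \<le> n"
  shows "distr M (lborel \<Otimes>\<^sub>M lborel) (\<lambda>\<omega>. (partial_sum X n \<omega>, partial_max X n \<omega>)) \<Otimes>\<^sub>M distr M lborel (X (Suc n))
    = distr M ((lborel \<Otimes>\<^sub>M lborel) \<Otimes>\<^sub>M lborel)
        (\<lambda>\<omega>. ((partial_sum X n \<omega>, partial_max X n \<omega>), X (Suc n) \<omega>))"
proof -
  let ?g = "\<lambda>w :: nat \<Rightarrow> real. (\<Sum>i=1..n. w i, Max ((\<lambda>i. w i) ` {1..n}))"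
  let ?k = "\<lambda>w :: nat \<Rightarrow> real. w (Suc n)"
  have g: "?g \<in> measurable (PiM {1..n} (\<lambda>_. borel)) (lborel \<Otimes>\<^sub>M lborel)"
    and k: "?k \<in> measurable (PiM {Suc n} (\<lambda>_. borel)) lborel"
    by measurable
  have ind: "indep_var (PiM {1..n} (\<lambda>_. borel)) (\<lambda>\<omega>. restrict (\<lambda>i. X i \<omega>) {1..n})
      (PiM {Suc n} (\<lambda>_. borel)) (\<lambda>\<omega>. restrict (\<lambda>i. X i \<omega>) {Suc n})"
    by (rule indep_var_restrict[OF assms(1)]) auto
  have "?g (restrict (\<lambda>i. X i \<omega>) {1..n}) = (partial_sum X n \<omega>, partial_max X n \<omega>)" for \<omega>
    by (simp add: partial_sum_def partial_max_def cong: image_cong_simp)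
  then show ?thesis
    using indep_var_distr_Pair[OF ind g k] by simp
qed

section \<open>From densities to distribution functions\<close>

lemma joint_pdf_Ordinary:
  assumes "prob_space M"
    and D: "distributed M (lborel \<Otimes>\<^sub>M lborel) (\<lambda>\<omega>. (Y \<omega>, Z \<omega>)) (\<lambda>(y, z). ennreal (h y z))"
    and nonneg: "\<And>y z. 0 \<le> h y z"
    and outside: "\<And>y z. (y, z) \<notin> S \<Longrightarrow> h y z = 0"
    and S: "S \<subseteq> {0..} \<times> {0..}"
  shows "joint_pdf M Y Z S (Ordinary h)"
proof -
  interpret prob_space M by fact
  let ?h = "\<lambda>p. h (fst p) (snd p)"
  have D': "distributed M (lborel \<Otimes>\<^sub>M lborel) (\<lambda>\<omega>. (Y \<omega>, Z \<omega>)) (\<lambda>p. ennreal (?h p))"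
    using D by (simp add: split_beta')
  have h[measurable]: "?h \<in> borel_measurable (lborel \<Otimes>\<^sub>M lborel)"
    by (rule distributed_real_measurable[OF _ D']) (rule nonneg)
  have W[measurable]: "(\<lambda>\<omega>. (Y \<omega>, Z \<omega>)) \<in> measurable M (lborel \<Otimes>\<^sub>M lborel)"
    using distributed_measurable[OF D] .
  have "measure M {\<omega> \<in> space M. Y \<omega> \<le> y \<and> Z \<omega> \<le> z}
      = (LINT z':{0..z}|lborel. LINT t:{0..y}|lborel. 1 * h t z')" for y z
  proof -
    let ?B = "{..y} \<times> {..z}"
    let ?k = "\<lambda>t z'. indicator {0..z} z' * (indicator {0..y} t * h t z')"
    have B[measurable]: "?B \<in> sets (lborel \<Otimes>\<^sub>M lborel)" by simp
    \<comment> \<open>Where \<open>?B\<close> and the box of the claim differ, some coordinate is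
      negative; such a point lies outside \<open>S\<close>, so \<open>h\<close> vanishes. This
      produces the lower limits 0.\<close>
    have k: "?h p * indicator ?B p = (case p of (t, z') \<Rightarrow> ?k t z')" for p
      using S outside by (auto simp: indicator_def split: prod.split)
    \<comment> \<open>Integrability is transferred to \<open>M\<close>, where it concerns a bounded
      function on a probability space.\<close>
    have int: "integrable (lborel \<Otimes>\<^sub>M lborel) (\<lambda>p. ?h p * indicator ?B p)"
      by (subst distributed_integrable[OF D']) (auto intro!: nonneg integrable_const_bound[where B=1] simp: indicator_def)
    have "measure M {\<omega> \<in> space M. Y \<omega> \<le> y \<and> Z \<omega> \<le> z} = (\<integral>\<omega>. indicator ?B (Y \<omega>, Z \<omega>) \<partial>M)"
    proof -
      have "(\<integral>\<omega>. indicator ?B (Y \<omega>, Z \<omega>) \<partial>M) = (\<integral>\<omega>. indicator {\<omega> \<in> space M. Y \<omega> \<le> y \<and> Z \<omega> \<le> z} \<omega> \<partial>M)"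
        by (rule Bochner_Integration.integral_cong) (auto simp: indicator_def)
      also have "\<dots> = measure M ({\<omega> \<in> space M. Y \<omega> \<le> y \<and> Z \<omega> \<le> z} \<inter> space M)"
        by (rule Bochner_Integration.integral_indicator)
      finally show ?thesis by (simp add: Int_absorb2)
    qed
    also have "\<dots> = (\<integral>p. ?h p * indicator ?B p \<partial>(lborel \<Otimes>\<^sub>M lborel))"
      by (subst distributed_integral[OF D']) (auto intro!: nonneg)
    also have "\<dots> = (\<integral>z'. \<integral>t. ?k t z' \<partial>lborel \<partial>lborel)"
      using int unfolding k by (rule lborel_pair.integral_snd[symmetric])
    also have "\<dots> = (LINT z':{0..z}|lborel. LINT t:{0..y}|lborel. 1 * h t z')"
      by (simp add: set_lebesgue_integral_def)
    finally show ?thesis .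
  qed
  then show ?thesis
    using nonneg outside by (simp add: joint_pdf_def)
qed

text \<open>Sum and maximum both equal \<open>X 1\<close>. The inner Dirac integral is
  \<open>f z'\<close> when \<open>z'\<close> lies in \<open>[0, y]\<close> and 0 otherwise, so the
  outer integral collects the mass of \<open>X 1\<close> up to \<open>min y z\<close>.\<close>

lemma joint_pdf_single:
  assumes "prob_space M" and X: "distributed M lborel (X 1) (\<lambda>x. ennreal (f x))"
    and nonneg: "\<And>x. 0 \<le> f x" and neg: "\<And>x. x < 0 \<Longrightarrow> f x = 0"
  shows "joint_pdf M (partial_sum X 1) (partial_max X 1) (Dom 1) (DiagDelta (\<lambda>y z. f y))"
proof -
  interpret prob_space M by fact
  have f[measurable]: "f \<in> borel_measurable borel"
    using distributed_real_measurable[OF _ X] nonneg by simp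
  have [measurable]: "X 1 \<in> borel_measurable M"
    using distributed_measurable[OF X] by simp
  have "measure M {\<omega> \<in> space M. partial_sum X 1 \<omega> \<le> y \<and> partial_max X 1 \<omega> \<le> z}
      = (LINT z':{0..z}|lborel. int_fst (\<lambda>_. 1) (DiagDelta (\<lambda>y z. f y)) z' 0 y)" for y z
  proof -
    let ?E = "{\<omega> \<in> space M. partial_sum X 1 \<omega> \<le> y \<and> partial_max X 1 \<omega> \<le> z}"
    have E: "indicator {..min y z} (X 1 \<omega>) = (indicator ?E \<omega> :: real)" if "\<omega> \<in> space M" for \<omega>
      using that by (simp add: partial_sum_def partial_max_def indicator_def)
    have "measure M ?E = (\<integral>\<omega>. indicator ?E \<omega> \<partial>M)"
      by (simp add: Int_absorb2)
    also have "\<dots> = (\<integral>\<omega>. indicator {..min y z} (X 1 \<omega>) \<partial>M)"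
      by (rule Bochner_Integration.integral_cong) (simp_all only: E)
    also have "\<dots> = (\<integral>x. f x * indicator {..min y z} x \<partial>lborel)"
      by (subst distributed_integral[OF X]) (auto intro!: nonneg)
    also have "\<dots> = (LINT z':{0..z}|lborel. int_fst (\<lambda>_. 1) (DiagDelta (\<lambda>y z. f y)) z' 0 y)"
      unfolding set_lebesgue_integral_def
    proof (rule Bochner_Integration.integral_cong[OF refl])
      fix x show "f x * indicator {..min y z} x
          = indicator {0..z} x *\<^sub>R int_fst (\<lambda>_. 1) (DiagDelta (\<lambda>y z. f y)) x 0 y"
        using neg[of x] by (cases "x < 0") (auto simp: dirac_integral_eq indicator_def)
    qed
    finally show ?thesis .
  qed
  then show ?thesis
    using nonneg neg by (auto simp: joint_pdf_def Dom_def)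
qed

section \<open>Induction along the recurrence\<close>

theorem theorem2p3:
  fixes M :: "'a measure"
    and X :: "nat \<Rightarrow> 'a \<Rightarrow> real"
    and f :: "nat \<Rightarrow> real \<Rightarrow> real"
  assumes "prob_space M"
    and "prob_space.indep_vars M (\<lambda>_. borel) X {1..}"
    and "\<And>i. 1 \<le> i \<Longrightarrow> AE \<omega> in M. 0 \<le> X i \<omega>"
    and "\<And>i. 1 \<le> i \<Longrightarrow> distributed M lborel (X i) (\<lambda>x. ennreal (f i x))"
    and "\<And>i x. 1 \<le> i \<Longrightarrow> 0 \<le> f i x"
    and "\<And>i. 1 \<le> i \<Longrightarrow> continuous_on {0..} (f i)"
    and "\<And>i x. 1 \<le> i \<Longrightarrow> x < 0 \<Longrightarrow> f i x = 0"
  shows "(\<forall>n\<ge>1. joint_pdf M (partial_sum X n) (partial_max X n) (Dom n) (rec_pdf f n))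
    \<and> rec_pdf f 1 = DiagDelta (\<lambda>y z. f 1 y)
    \<and> gfun_eq (DiagDelta (\<lambda>y z. f 1 y)) (DiagDelta (\<lambda>y z. f 1 z))
    \<and> (\<forall>n\<ge>2. \<exists>h. rec_pdf f n = Ordinary h
        \<and> distributed M (lborel \<Otimes>\<^sub>M lborel) (\<lambda>\<omega>. (partial_sum X n \<omega>, partial_max X n \<omega>))
            (\<lambda>(y, z). ennreal (h y z))
        \<and> (\<forall>y z. (y, z) \<notin> Dom n \<longrightarrow> h y z = 0)
        \<and> (\<forall>y z. (y, z) \<in> Dom n \<longrightarrow>
             h y z = f n z * int_snd (\<lambda>_. 1) (rec_pdf f (n - 1)) (y - z) 0 z
                   + int_conv (f n) (rec_pdf f (n - 1)) y z 0 z)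
        \<and> (\<forall>y z. (y, z) \<in> Dom n \<longrightarrow>
             h y z = f n z * int_snd (\<lambda>_. 1) (rec_pdf f (n - 1)) (y - z)
                         ((y - z) / (real n - 1)) (min (y - z) z)
                   + int_conv (f n) (rec_pdf f (n - 1)) y z
                         (max (y - (real n - 1) * z) 0) (min (y - z) z))
        \<and> continuous_on (Dom n) (\<lambda>(y, z). h y z))"
proof -
  interpret prob_space M by fact
  note ind = assms(2) and D = assms(4) and nonneg = assms(5) and cont = assms(6) and neg = assms(7)
  have meas: "f i \<in> borel_measurable borel" if "1 \<le> i" for i
    using distributed_real_measurable[OF _ D[OF that]] nonneg[OF that] by simp
  have [measurable]: "f 1 \<in> borel_measurable borel" "f (Suc 0) \<in> borel_measurable borel"
    and [measurable]: "f 2 \<in> borel_measurable borel"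
    using meas[of 1] meas[of 2] by simp_all
  \<comment> \<open>The induction starts at 2, where the generalized function gives way to an
    ordinary one. Nonnegativity of \<open>h\<close> is added to the invariant because the next step
    needs it.\<close>
  have rec: "\<exists>h. rec_pdf f n = Ordinary h
        \<and> distributed M (lborel \<Otimes>\<^sub>M lborel) (\<lambda>\<omega>. (partial_sum X n \<omega>, partial_max X n \<omega>))
            (\<lambda>(y, z). ennreal (h y z))
        \<and> (\<forall>y z. 0 \<le> h y z)
        \<and> (\<forall>y z. (y, z) \<notin> Dom n \<longrightarrow> h y z = 0)
        \<and> (\<forall>y z. (y, z) \<in> Dom n \<longrightarrow>
             h y z = f n z * int_snd (\<lambda>_. 1) (rec_pdf f (n - 1)) (y - z) 0 z
                   + int_conv (f n) (rec_pdf f (n - 1)) y z 0 z)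
        \<and> (\<forall>y z. (y, z) \<in> Dom n \<longrightarrow>
             h y z = f n z * int_snd (\<lambda>_. 1) (rec_pdf f (n - 1)) (y - z)
                         ((y - z) / (real n - 1)) (min (y - z) z)
                   + int_conv (f n) (rec_pdf f (n - 1)) y z
                         (max (y - (real n - 1) * z) 0) (min (y - z) z))
        \<and> continuous_on (Dom n) (\<lambda>(y, z). h y z)" (is "\<exists>h. ?P n h") if "2 \<le> n" for n
    using that
  proof (induction n rule: nat_induct_at_least)
    case base
    define h where "h y z = (if (y, z) \<in> Dom 2
      then f 2 z * int_snd (\<lambda>_. 1) (rec_pdf f 1) (y - z) 0 z + int_conv (f 2) (rec_pdf f 1) y z 0 z else 0)" for y z
    \<comment> \<open>Both unit masses sit at \<open>y - z\<close>, and on \<open>Dom 2\<close> this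
      point lies in \<open>[0, z]\<close>; as endpoints count fully, the boundary needs no separate
      formula.\<close>
    have h_eq: "h y z = (if (y, z) \<in> Dom 2 then f 2 z * f 1 (y - z) + f 2 (y - z) * f 1 z else 0)" for y z
      by (auto simp: h_def dirac_integral_eq Dom_def)
    have "distributed M (lborel \<Otimes>\<^sub>M lborel) (\<lambda>\<omega>. (partial_sum X 2 \<omega>, partial_max X 2 \<omega>)) (\<lambda>(y, z). ennreal (h y z))"
    proof -
      have "distr M lborel (X 1) \<Otimes>\<^sub>M distr M lborel (X 2) = distr M (lborel \<Otimes>\<^sub>M lborel) (\<lambda>\<omega>. (X 1 \<omega>, X 2 \<omega>))"
        using indep_var_distr_Pair[OF indep_var_restrict[OF ind, of "{1}" "{2}"],
            of "\<lambda>w. w 1" lborel "\<lambda>w. w 2" lborel]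
        by simp
      from distributed_add_max[OF D D this]
      have "distributed M (lborel \<Otimes>\<^sub>M lborel) (\<lambda>\<omega>. (X 1 \<omega> + X 2 \<omega>, max (X 1 \<omega>) (X 2 \<omega>)))
        (\<lambda>(y, z). (ennreal (f 2 z) * ennreal (f 1 (y - z)) + ennreal (f 2 (y - z)) * ennreal (f 1 z)) * indicator {..z} (y - z))"
        by simp
      moreover have "(ennreal (f 2 z) * ennreal (f 1 (y - z)) + ennreal (f 2 (y - z)) * ennreal (f 1 z)) * indicator {..z} (y - z)
          = ennreal (h y z)" for y z
      proof (cases "(y, z) \<in> Dom 2")
        case True
        then show ?thesis
          using nonneg by (simp add: h_eq Dom_def ennreal_plus ennreal_mult)
      next
        case False
        \<comment> \<open>These are the ways to leave \<open>Dom 2\<close>: in the first two, each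
          product has a density factor at a negative argument, and in the third the indicator is
          0.\<close>
        then consider "z < 0" | "y - z < 0" | "y - z > z" by (force simp: Dom_def)
        then show ?thesis
          using False neg by cases (simp_all add: h_eq)
      qed
      moreover have "partial_sum X 2 \<omega> = X 1 \<omega> + X 2 \<omega>" "partial_max X 2 \<omega> = max (X 1 \<omega>) (X 2 \<omega>)" for \<omega>
        by (simp_all add: numeral_2_eq_2 partial_sum_Suc partial_max_Suc)
           (simp_all add: partial_sum_def partial_max_def)
      ultimately show ?thesis by simp
    qed
    moreover have "continuous_on (Dom 2) (\<lambda>(y, z). h y z)"
    proof -
      have "continuous_on (Dom 2) (\<lambda>p. f 2 (snd p) * f 1 (fst p - snd p) + f 2 (fst p - snd p) * f 1 (snd p))"
        by (intro continuous_on_add continuous_on_mult continuous_on_compose2[OF cont] continuous_intros)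
           (auto simp: Dom_def)
      then show ?thesis
        by (rule continuous_on_eq) (auto simp: h_eq)
    qed
    moreover have "rec_pdf f 2 = Ordinary h"
      by (simp add: numeral_2_eq_2 h_def fun_eq_iff)
    \<comment> \<open>For \<open>n = 2\<close> both windows shrink to the single point
      \<open>y - z\<close>, and the closed-interval convention still assigns it the whole unit
      mass.\<close>
    moreover have "h y z = f 2 z * int_snd (\<lambda>_. 1) (rec_pdf f (2 - 1)) (y - z) ((y - z) / (real 2 - 1)) (min (y - z) z)
        + int_conv (f 2) (rec_pdf f (2 - 1)) y z (max (y - (real 2 - 1) * z) 0) (min (y - z) z)"
      if "(y, z) \<in> Dom 2" for y z
      using that by (auto simp: h_eq dirac_integral_eq Dom_def)
    moreover have "h y z = f 2 z * int_snd (\<lambda>_. 1) (rec_pdf f (2 - 1)) (y - z) 0 z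
        + int_conv (f 2) (rec_pdf f (2 - 1)) y z 0 z" if "(y, z) \<in> Dom 2" for y z
      using that by (simp add: h_def)
    moreover have "0 \<le> h y z" for y z
      using nonneg by (simp add: h_eq)
    moreover have "h y z = 0" if "(y, z) \<notin> Dom 2" for y z
      using that by (simp add: h_eq)
    ultimately show ?case
      by (intro exI[of _ h] conjI allI impI)
  next
    case (Suc n)
    then obtain r where r: "?P n r" by (elim exE)
    let ?h = "step_pdf n (f (Suc n)) r"
    \<comment> \<open>Exhibits \<open>Suc n\<close> as a double successor, so that the last clause
      of \<open>rec_pdf\<close> unfolds.\<close>
    from \<open>2 \<le> n\<close> obtain k where k: "n = Suc k" by (cases n) auto
    have n: "1 \<le> n" and n': "1 \<le> Suc n" using \<open>2 \<le> n\<close> by simp_all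
    from r have rn: "rec_pdf f n = Ordinary r" by (rule conjunct1)
    interpret recurrence_step n "f (Suc n)" r
      by unfold_locales (use n r nonneg cont neg in simp_all)
    have "rec_pdf f (Suc n) = Ordinary ?h"
      using rn by (simp add: k step_pdf_def fun_eq_iff)
    moreover have "distributed M (lborel \<Otimes>\<^sub>M lborel) (\<lambda>\<omega>. (partial_sum X (Suc n) \<omega>, partial_max X (Suc n) \<omega>))
        (\<lambda>(y, z). ennreal (?h y z))"
    proof -
      from r have "distributed M (lborel \<Otimes>\<^sub>M lborel) (\<lambda>\<omega>. (partial_sum X n \<omega>, partial_max X n \<omega>))
            (\<lambda>(y, z). ennreal (r y z))" by (elim conjE)
      from distributed_pair_add_max[OF this D[OF n'] indep_partial_sum_max[OF ind n]]
      show ?thesis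
        unfolding ennreal_step_pdf partial_sum_Suc partial_max_Suc[OF n] prod.case .
    qed
    moreover have "?h y z = f (Suc n) z * int_snd (\<lambda>_. 1) (rec_pdf f (Suc n - 1)) (y - z) 0 z
                   + int_conv (f (Suc n)) (rec_pdf f (Suc n - 1)) y z 0 z"
        "?h y z = f (Suc n) z * int_snd (\<lambda>_. 1) (rec_pdf f (Suc n - 1)) (y - z)
                         ((y - z) / (real (Suc n) - 1)) (min (y - z) z)
                   + int_conv (f (Suc n)) (rec_pdf f (Suc n - 1)) y z
                         (max (y - (real (Suc n) - 1) * z) 0) (min (y - z) z)"
      if "(y, z) \<in> Dom (Suc n)" for y z
      using that step_fst_window[OF that] step_conv_window[OF that]
      by (simp_all add: rn step_pdf_def)
    moreover have "?h y z = 0" if "(y, z) \<notin> Dom (Suc n)" for y z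
      using that by (simp add: step_pdf_def)
    moreover note step_pdf_nonneg continuous_on_step_pdf
    ultimately show ?case
      by (intro exI[of _ ?h] conjI allI impI)
  qed
  have "joint_pdf M (partial_sum X n) (partial_max X n) (Dom n) (rec_pdf f n)" if "1 \<le> n" for n
  proof (cases "n = 1")
    case True
    then show ?thesis
      using joint_pdf_single[where f="f 1" and X=X, OF assms(1) D[of 1]] nonneg neg by simp
  next
    case False
    with that rec[of n] obtain h where h: "rec_pdf f n = Ordinary h"
        "distributed M (lborel \<Otimes>\<^sub>M lborel) (\<lambda>\<omega>. (partial_sum X n \<omega>, partial_max X n \<omega>)) (\<lambda>(y, z). ennreal (h y z))"
        "\<forall>y z. 0 \<le> h y z" "\<forall>y z. (y, z) \<notin> Dom n \<longrightarrow> h y z = 0"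
      by auto
    show ?thesis
      unfolding h(1) by (rule joint_pdf_Ordinary[OF assms(1) h(2)]) (use h in \<open>auto simp: Dom_def\<close>)
  qed
  moreover have "gfun_eq (DiagDelta (\<lambda>y z. f 1 y)) (DiagDelta (\<lambda>y z. f 1 z))"
    unfolding gfun_eq_def
  proof (intro allI impI)
    fix w :: "real \<Rightarrow> real" assume "continuous_on UNIV w"
    then have [measurable]: "w \<in> borel_measurable borel"
      by (rule borel_measurable_continuous_onI)
    show "(\<forall>z a b. int_fst w (DiagDelta (\<lambda>y z. f 1 y)) z a b = int_fst w (DiagDelta (\<lambda>y z. f 1 z)) z a b) \<and>
      (\<forall>y a b. int_snd w (DiagDelta (\<lambda>y z. f 1 y)) y a b = int_snd w (DiagDelta (\<lambda>y z. f 1 z)) y a b) \<and>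
      (\<forall>y z a b. int_conv w (DiagDelta (\<lambda>y z. f 1 y)) y z a b = int_conv w (DiagDelta (\<lambda>y z. f 1 z)) y z a b)"
      \<comment> \<open>Each unit mass evaluates its integrand where the two arguments of the
        coefficient coincide, so \<open>f 1 y\<close> and \<open>f 1 z\<close> give the same
        value.\<close>
      by (simp add: dirac_integral_eq)
  qed
  moreover have "rec_pdf f 1 = DiagDelta (\<lambda>y z. f 1 y)"
    by simp
  ultimately show ?thesis
    using rec by (intro conjI allI impI) (blast+)
qed

end
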